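(* Permutations whose $\Theta$-image is fixed under $\Theta$ are counted by the Catalan numbers: for every $n\ge 0$, $|S_{n,1}|=C_n=\frac{1}{n+1}\binom{2n}{n}$.
   Context: $S_n$ is the set of permutations of $\{0,1,\ldots,n-1\}$, written as sequences of length $n$. $I_n$ is the set of inversion sequences of length $n$, i.e. integer sequences $\sigma=(\sigma_1,\ldots,\sigma_n)$ with $0\le\sigma_i<i$ for every $1\le i\le n$ (the empty sequence is allowed, with $n=0$). For a finite integer sequence $\sigma$ of length $n$, $\Theta(\sigma)$ is the sequence of length $n$ defined by $\Theta(\sigma)_i=\#\{j<i:\sigma_j<\sigma_i\}$. $FP_n=\{\sigma\in I_n:\Theta(\sigma)=\sigma\}$ and $S_{n,1}=\{\sigma\in S_n:\Theta(\sigma)\in FP_n\}$. *)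

theory Defs
  imports Complex_Main "HOL-Combinatorics.Multiset_Permutations"
begin

text \<open>Finite integer sequences are lists of integers. List positions start at 0, so the
  entry with index i (for i = 1, ..., n) of a sequence s is \<open>s ! (i - 1)\<close>.\<close>

definition Theta :: "int list \<Rightarrow> int list" where
  "Theta \<sigma> = map (\<lambda>i. int (card {j. j < i \<and> \<sigma> ! j < \<sigma> ! i})) [0..<length \<sigma>]"

definition perms :: "nat \<Rightarrow> int list set" where
  "perms n = permutations_of_set {0..<int n}"

text \<open>Because of the shifted positions, the bound on the entry at position i is \<open>Suc i\<close>.\<close>

definition inversion_seqs :: "nat \<Rightarrow> int list set" where
  "inversion_seqs n =
     {\<sigma>. length \<sigma> = n \<and> (\<forall>i<n. 0 \<le> \<sigma> ! i \<and> \<sigma> ! i < int (Suc i))}"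

definition FP :: "nat \<Rightarrow> int list set" where
  "FP n = {\<sigma> \<in> inversion_seqs n. Theta \<sigma> = \<sigma>}"

definition S1 :: "nat \<Rightarrow> int list set" where
  "S1 n = {\<sigma> \<in> perms n. Theta \<sigma> \<in> FP n}"

end

theory Submission
  imports Defs
begin

text \<open>\<open>Theta\<close> is a bijection from permutations to inversion sequences, since the last entry of
  \<open>Theta \<sigma>\<close> is the rank of the last entry of \<open>\<sigma>\<close>. So \<open>S1 n\<close> has as many elements as \<open>FP n\<close>.
  A fixed point \<open>\<sigma>\<close> of length \<open>m\<close> extends to a fixed point \<open>\<sigma> @ [v]\<close> exactly for the \<open>v\<close> in
  the set of those \<open>v\<close> for which \<open>\<sigma>\<close> has exactly \<open>v\<close> entries below \<open>v\<close>. If this set is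
  \<open>v\<^sub>0 < \<dots> < v\<^sub>k\<close>, then the set for \<open>\<sigma> @ [v\<^sub>i]\<close> is \<open>v\<^sub>0 < \<dots> < v\<^sub>i < m + 1\<close>. Hence fixed
  points form the Catalan generating tree, in which a node labelled \<open>k\<close> has children labelled
  \<open>2, \<dots>, k + 1\<close>.\<close>

section \<open>Bijection between permutations and inversion sequences\<close>

text \<open>Rank is strictly increasing, hence injective, and counting gives surjectivity. It serves
  both to recover the last entry of a permutation and to reindex the sum over active sites.\<close>

lemma bij_betw_rank:
  fixes A :: "'a::linorder set"
  assumes "finite A"
  shows "bij_betw (\<lambda>x. card {y \<in> A. y < x}) A {..<card A}"
proof -
  let ?r = "\<lambda>x. card {y \<in> A. y < x}"
  have mono: "?r x < ?r y" if "x \<in> A" "x < y" for x y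
    using that assms by (intro psubset_card_mono) auto
  have inj: "inj_on ?r A"
  proof (rule inj_onI)
    fix x y assume "x \<in> A" "y \<in> A" "?r x = ?r y"
    then show "x = y"
      using mono[of x y] mono[of y x] by (cases x y rule: linorder_cases) simp_all
  qed
  have "?r x < card A" if "x \<in> A" for x
    using that assms by (intro psubset_card_mono) auto
  then have "?r ` A = {..<card A}"
    using inj by (intro card_subset_eq) (auto simp: card_image)
  with inj show ?thesis by (simp add: bij_betw_def)
qed

lemma length_Theta [simp]: "length (Theta \<sigma>) = length \<sigma>"
  by (simp add: Theta_def)

lemma Theta_Nil [simp]: "Theta [] = []"
  by (simp add: Theta_def)

lemma Theta_snoc:
  "Theta (\<sigma> @ [v]) = Theta \<sigma> @ [int (length (filter (\<lambda>x. x < v) \<sigma>))]"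
proof -
  have "{j. j < i \<and> (\<sigma> @ [v]) ! j < (\<sigma> @ [v]) ! i} = {j. j < i \<and> \<sigma> ! j < \<sigma> ! i}"
    if "i < length \<sigma>" for i
    using that by (auto simp: nth_append)
  moreover have "{j. j < length \<sigma> \<and> (\<sigma> @ [v]) ! j < v} = {j. j < length \<sigma> \<and> \<sigma> ! j < v}"
    by (auto simp: nth_append)
  ultimately show ?thesis
    by (simp add: Theta_def length_filter_conv_card)
qed

lemma Theta_snoc_distinct:
  assumes "distinct (\<sigma> @ [v])"
  shows "Theta (\<sigma> @ [v]) = Theta \<sigma> @ [int (card {y \<in> set (\<sigma> @ [v]). y < v})]"
proof -
  have "length (filter (\<lambda>x. x < v) \<sigma>) = card (set (filter (\<lambda>x. x < v) \<sigma>))"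
    using assms by (metis distinct_append distinct_card distinct_filter)
  also have "set (filter (\<lambda>x. x < v) \<sigma>) = {y \<in> set (\<sigma> @ [v]). y < v}"
    by auto
  finally show ?thesis by (simp add: Theta_snoc)
qed

text \<open>The last entry of the image is a rank in the common set, so it determines the last entry
  of the list; removing that entry leaves equal sets.\<close>

lemma Theta_inj_distinct:
  assumes "distinct \<sigma>" "distinct \<tau>" "set \<sigma> = set \<tau>" "Theta \<sigma> = Theta \<tau>"
  shows "\<sigma> = \<tau>"
  using assms
proof (induction \<sigma> arbitrary: \<tau> rule: rev_induct)
  case Nil
  then show ?case by simp
next
  case (snoc v \<sigma>)
  obtain \<tau>' w where \<tau>: "\<tau> = \<tau>' @ [w]"
    using snoc.prems(3) by (cases \<tau> rule: rev_cases) auto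
  let ?X = "set (\<sigma> @ [v])"
  have X: "set (\<tau>' @ [w]) = ?X"
    using snoc.prems(3) \<tau> by simp
  have "Theta (\<tau>' @ [w]) = Theta \<tau>' @ [int (card {y \<in> ?X. y < w})]"
    using Theta_snoc_distinct[of \<tau>' w] snoc.prems(2) unfolding X \<tau> by blast
  then have "Theta \<sigma> @ [int (card {y \<in> ?X. y < v})] = Theta \<tau>' @ [int (card {y \<in> ?X. y < w})]"
    using snoc.prems(4) Theta_snoc_distinct[OF snoc.prems(1)] unfolding \<tau> by metis
  then have eq: "Theta \<sigma> = Theta \<tau>'" "card {y \<in> ?X. y < v} = card {y \<in> ?X. y < w}"
    by (simp_all only: append1_eq_conv of_nat_eq_iff)
  moreover have "w \<in> ?X" "v \<in> ?X"
    using X by auto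
  ultimately have "v = w"
    using bij_betw_imp_inj_on[OF bij_betw_rank[of ?X]] by (auto dest: inj_onD)
  moreover have "set \<sigma> = set \<tau>'"
    using X snoc.prems(1,2) \<open>v = w\<close> unfolding \<tau> by auto
  moreover have "\<sigma> = \<tau>'"
    by (rule snoc.IH) (use snoc.prems(1,2) eq(1) \<tau> \<open>set \<sigma> = set \<tau>'\<close> in simp_all)
  ultimately show ?case
    using \<tau> by simp
qed

text \<open>An arbitrary finite \<open>X\<close> is taken because the induction deletes the last
  entry, and what remains of an interval need not be one.\<close>

lemma Theta_surj_inversion_seqs:
  assumes "finite X" "s \<in> inversion_seqs (card X)"
  shows "\<exists>\<sigma> \<in> permutations_of_set X. Theta \<sigma> = s"
  using assms
proof (induction s arbitrary: X rule: rev_induct)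
  case Nil
  then show ?case by (auto simp: inversion_seqs_def)
next
  case (snoc v s)
  have len: "card X = Suc (length s)"
    and bnd: "\<And>i. i < Suc (length s) \<Longrightarrow> 0 \<le> (s @ [v]) ! i \<and> (s @ [v]) ! i < int (Suc i)"
    using snoc.prems(2) by (auto simp: inversion_seqs_def)
  have v: "0 \<le> v" "v < int (card X)"
    using bnd[of "length s"] len by auto
  then have "nat v \<in> (\<lambda>x. card {y \<in> X. y < x}) ` X"
    using bij_betw_imp_surj_on[OF bij_betw_rank[OF snoc.prems(1)]] by auto
  then obtain x where x: "x \<in> X" "nat v = card {y \<in> X. y < x}"
    by auto
  have "s \<in> inversion_seqs (card (X - {x}))"
    unfolding inversion_seqs_def
  proof (intro CollectI conjI allI impI)
    show len': "length s = card (X - {x})"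
      using len x(1) snoc.prems(1) by simp
    fix i assume "i < card (X - {x})"
    then show "0 \<le> s ! i" "s ! i < int (Suc i)"
      using bnd[of i] len' by (simp_all add: nth_append)
  qed
  then obtain \<sigma> where \<sigma>: "\<sigma> \<in> permutations_of_set (X - {x})" "Theta \<sigma> = s"
    using snoc.IH[of "X - {x}"] snoc.prems(1) by auto
  then have p: "distinct (\<sigma> @ [x])" "set (\<sigma> @ [x]) = X"
    using x(1) by (auto simp: permutations_of_set_def)
  then have "Theta (\<sigma> @ [x]) = s @ [v]"
    using Theta_snoc_distinct[OF p(1)] \<sigma>(2) x(2) v(1) by simp
  moreover have "\<sigma> @ [x] \<in> permutations_of_set X"
    using p by (simp only: permutations_of_setI)
  ultimately show ?case
    by blast
qed

lemma card_S1_eq_card_FP: "card (S1 n) = card (FP n)"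
proof -
  have "Theta ` S1 n = FP n"
    using Theta_surj_inversion_seqs[of "{0..<int n}"]
    by (force simp: S1_def FP_def perms_def)
  moreover have "inj_on Theta (S1 n)"
    by (rule inj_onI, rule Theta_inj_distinct)
      (auto simp: S1_def perms_def permutations_of_set_def)
  ultimately show ?thesis
    by (metis card_image)
qed

section \<open>Fixed points and their active sites\<close>

lemma Theta_fixed_in_inversion_seqs:
  assumes "Theta \<sigma> = \<sigma>"
  shows "\<sigma> \<in> inversion_seqs (length \<sigma>)"
  unfolding inversion_seqs_def
proof (intro CollectI conjI allI impI)
  fix i assume i: "i < length \<sigma>"
  have "\<sigma> ! i = Theta \<sigma> ! i"
    by (simp only: assms)
  also have "\<dots> = int (card {j. j < i \<and> \<sigma> ! j < \<sigma> ! i})"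
    using i by (simp add: Theta_def)
  finally have "\<sigma> ! i = int (card {j. j < i \<and> \<sigma> ! j < \<sigma> ! i})" .
  moreover have "card {j. j < i \<and> \<sigma> ! j < \<sigma> ! i} \<le> i"
    using card_mono[of "{..<i}" "{j. j < i \<and> \<sigma> ! j < \<sigma> ! i}"] by auto
  ultimately show "0 \<le> \<sigma> ! i" "\<sigma> ! i < int (Suc i)"
    by linarith+
qed simp

lemma FP_eq: "FP n = {\<sigma>. length \<sigma> = n \<and> Theta \<sigma> = \<sigma>}"
  using Theta_fixed_in_inversion_seqs by (auto simp: FP_def inversion_seqs_def)

definition active_sites :: "int list \<Rightarrow> int set" where
  "active_sites \<sigma> = {v. int (length (filter (\<lambda>x. x < v) \<sigma>)) = v}"

lemma Theta_fixed_snoc_iff: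
  "Theta (\<sigma> @ [v]) = \<sigma> @ [v] \<longleftrightarrow> Theta \<sigma> = \<sigma> \<and> v \<in> active_sites \<sigma>"
  by (auto simp: Theta_snoc active_sites_def)

lemma Theta_fixed_appendD: "Theta (\<sigma> @ \<tau>) = \<sigma> @ \<tau> \<Longrightarrow> Theta \<sigma> = \<sigma>"
proof (induction \<tau> rule: rev_induct)
  case (snoc v \<tau>)
  from snoc.prems have "Theta ((\<sigma> @ \<tau>) @ [v]) = (\<sigma> @ \<tau>) @ [v]"
    by (simp only: append_assoc)
  then have "Theta (\<sigma> @ \<tau>) = \<sigma> @ \<tau>"
    by (simp only: Theta_fixed_snoc_iff)
  then show ?case
    by (rule snoc.IH)
qed simp

lemma active_sites_subset: "active_sites \<sigma> \<subseteq> {0..int (length \<sigma>)}"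
proof
  fix v assume "v \<in> active_sites \<sigma>"
  then have "int (length (filter (\<lambda>x. x < v) \<sigma>)) = v"
    by (simp only: active_sites_def mem_Collect_eq)
  with length_filter_le[of "\<lambda>x. x < v" \<sigma>] show "v \<in> {0..int (length \<sigma>)}"
    unfolding atLeastAtMost_iff by linarith
qed

lemma finite_active_sites [simp]: "finite (active_sites \<sigma>)"
  using active_sites_subset finite_subset by blast

text \<open>Appending \<open>v < w\<close> raises the count by one; appending
  \<open>v \<ge> w\<close> keeps it, but then \<open>w\<close> is at most the old length. The bound
  shows which sites die when an entry is appended.\<close>

lemma Theta_fixed_count_ge:
  assumes "Theta \<sigma> = \<sigma>" "w \<le> int (length \<sigma>)"
  shows "w \<le> int (length (filter (\<lambda>x. x < w) \<sigma>))"
  using assms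
proof (induction \<sigma> rule: rev_induct)
  case (snoc v \<sigma>)
  have fixed: "Theta \<sigma> = \<sigma>" and v: "v \<in> active_sites \<sigma>"
    using snoc.prems(1) Theta_fixed_snoc_iff[of \<sigma> v] by blast+
  show ?case
  proof (cases "v < w")
    case True
    consider "w \<le> int (length \<sigma>)" | "w = int (length \<sigma>) + 1"
      using snoc.prems(2) by force
    then show ?thesis
    proof cases
      case 1
      then show ?thesis using snoc.IH[OF fixed] True by simp
    next
      case 2
      \<comment> \<open>The induction hypothesis does not reach this \<open>w\<close>, but all
        entries of an inversion sequence lie below its length.\<close>
      have "x < w" if "x \<in> set \<sigma>" for x
      proof -
        from that obtain i where "i < length \<sigma>" "x = \<sigma> ! i"
          by (auto simp: in_set_conv_nth)
        moreover have "\<sigma> ! i < int (Suc i)"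
          using Theta_fixed_in_inversion_seqs[OF fixed] \<open>i < length \<sigma>\<close>
          unfolding inversion_seqs_def by blast
        ultimately show ?thesis
          using 2 by linarith
      qed
      then have "filter (\<lambda>x. x < w) \<sigma> = \<sigma>"
        by (simp add: filter_id_conv)
      with 2 True show ?thesis by simp
    qed
  next
    case False
    moreover have "v \<le> int (length \<sigma>)"
      using v active_sites_subset[of \<sigma>] by auto
    ultimately show ?thesis
      using snoc.IH[OF fixed] by simp
  qed
qed simp

lemma active_sites_snoc:
  assumes "Theta \<sigma> = \<sigma>" "v \<in> active_sites \<sigma>"
  shows "active_sites (\<sigma> @ [v]) = insert (int (length \<sigma>) + 1) {w \<in> active_sites \<sigma>. w \<le> v}"
proof (intro set_eqI)
  fix w
  let ?m = "int (length \<sigma>)"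
  have v: "v \<le> ?m"
    using assms(2) active_sites_subset[of \<sigma>] by auto
  consider "w \<le> v" | "v < w" "w \<le> ?m" | "w = ?m + 1" | "w > ?m + 1"
    using v by linarith
  then show "w \<in> active_sites (\<sigma> @ [v])
      \<longleftrightarrow> w \<in> insert (?m + 1) {w \<in> active_sites \<sigma>. w \<le> v}"
  proof cases
    case 1
    then show ?thesis using v by (auto simp: active_sites_def)
  next
    case 2
    \<comment> \<open>At least \<open>w\<close> old entries lie below \<open>w\<close>, and
      \<open>v\<close> is one more, so the count exceeds \<open>w\<close>.\<close>
    then show ?thesis
      using Theta_fixed_count_ge[OF assms(1), of w] by (auto simp: active_sites_def)
  next
    case 3
    have "Theta (\<sigma> @ [v]) = \<sigma> @ [v]"
      using assms by (simp only: Theta_fixed_snoc_iff)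
    \<comment> \<open>The count is squeezed between \<open>w\<close> and the new length, which
      equals \<open>w\<close>.\<close>
    then have "w \<le> int (length (filter (\<lambda>x. x < w) (\<sigma> @ [v])))"
      by (rule Theta_fixed_count_ge) (use 3 in simp)
    moreover have "length (filter (\<lambda>x. x < w) (\<sigma> @ [v])) \<le> length (\<sigma> @ [v])"
      by (rule length_filter_le)
    moreover have "int (length (\<sigma> @ [v])) = w"
      using 3 by simp
    ultimately have "w \<in> active_sites (\<sigma> @ [v])"
      unfolding active_sites_def mem_Collect_eq by linarith
    with 3 show ?thesis by simp
  next
    case 4
    then show ?thesis
      using v active_sites_subset[of "\<sigma> @ [v]"] by auto
  qed
qed

text \<open>The 2 stands for \<open>v\<close> itself and the new largest site. The rest is the rank
  of \<open>v\<close>, so the children's labels run over \<open>j + 2\<close> for ranks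
  \<open>j\<close>.\<close>

lemma card_active_sites_snoc:
  assumes "Theta \<sigma> = \<sigma>" "v \<in> active_sites \<sigma>"
  shows "card (active_sites (\<sigma> @ [v])) = card {w \<in> active_sites \<sigma>. w < v} + 2"
proof -
  have "{w \<in> active_sites \<sigma>. w \<le> v} = insert v {w \<in> active_sites \<sigma>. w < v}"
    using assms(2) by auto
  moreover have "int (length \<sigma>) + 1 \<notin> {w \<in> active_sites \<sigma>. w \<le> v}"
    using active_sites_subset[of \<sigma>] by auto
  ultimately show ?thesis
    by (simp add: active_sites_snoc[OF assms])
qed

section \<open>Counting in the Catalan tree\<close>

text \<open>The number of descendants at depth \<open>n\<close> of a node labelled \<open>k\<close> in the Catalan tree.\<close>

fun descendants :: "nat \<Rightarrow> nat \<Rightarrow> nat" where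
  "descendants 0 k = 1"
| "descendants (Suc n) k = (\<Sum>j<k. descendants n (j + 2))"

text \<open>Extensions are split by their first entry, an active site. Finiteness is carried along
  for the cardinality of the disjoint union.\<close>

lemma card_Theta_fixed_extensions:
  assumes "Theta \<sigma> = \<sigma>"
  shows "finite {\<tau>. length \<tau> = n \<and> Theta (\<sigma> @ \<tau>) = \<sigma> @ \<tau>} \<and>
    card {\<tau>. length \<tau> = n \<and> Theta (\<sigma> @ \<tau>) = \<sigma> @ \<tau>} = descendants n (card (active_sites \<sigma>))"
  using assms
proof (induction n arbitrary: \<sigma>)
  case 0
  then have "{\<tau>. length \<tau> = 0 \<and> Theta (\<sigma> @ \<tau>) = \<sigma> @ \<tau>} = {[]}"
    by auto
  then show ?case by simp
next
  case (Suc n)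
  let ?E = "\<lambda>n \<sigma>. {\<tau>. length \<tau> = n \<and> Theta (\<sigma> @ \<tau>) = \<sigma> @ \<tau>}"
  let ?A = "active_sites \<sigma>"
  have fixed: "Theta (\<sigma> @ [v]) = \<sigma> @ [v]" if "v \<in> ?A" for v
    using that Suc.prems by (simp only: Theta_fixed_snoc_iff)
  have "v \<in> ?A" if "Theta (\<sigma> @ v # \<tau>) = \<sigma> @ v # \<tau>" for v \<tau>
    using that Theta_fixed_appendD[of "\<sigma> @ [v]" \<tau>] Theta_fixed_snoc_iff[of \<sigma> v] by simp
  then have E: "?E (Suc n) \<sigma> = (\<Union>v\<in>?A. (#) v ` ?E n (\<sigma> @ [v]))"
    by (auto simp: length_Suc_conv image_iff)
  have "card (?E (Suc n) \<sigma>) = (\<Sum>v\<in>?A. card ((#) v ` ?E n (\<sigma> @ [v])))"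
    unfolding E using Suc.IH[OF fixed] by (intro card_UN_disjoint) auto
  also have "\<dots> = (\<Sum>v\<in>?A. descendants n (card {w \<in> ?A. w < v} + 2))"
    using Suc.IH[OF fixed] card_active_sites_snoc[OF Suc.prems]
    by (intro sum.cong) (auto simp: card_image)
  also have "\<dots> = (\<Sum>j<card ?A. descendants n (j + 2))"
    by (rule sum.reindex_bij_betw[OF bij_betw_rank]) simp
  finally show ?case
    using Suc.IH[OF fixed] unfolding E by simp
qed

text \<open>The ballot numbers \<open>(2n + k choose n) - (2n + k choose n - 1)\<close>; the second coefficient is
  reflected so that it vanishes for \<open>n = 0\<close>.\<close>

lemma descendants_ballot:
  "descendants n (Suc k) + (2 * n + k choose (n + k + 1)) = (2 * n + k choose n)"
proof (induction n arbitrary: k)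
  case 0
  then show ?case by simp
next
  case (Suc n)
  \<comment> \<open>With the label shifted to \<open>k\<close>, the base case is an empty sum.
    Raising \<open>k\<close> by one adds \<open>descendants n (k + 2)\<close>, given by the outer
    hypothesis, and Pascal's rule combines both binomials.\<close>
  have "descendants (Suc n) k + (2 * n + 1 + k choose (n + 1 + k)) = (2 * n + 1 + k choose (n + 1))"
    for k
  proof (induction k)
    case 0
    then show ?case by simp
  next
    case (Suc k)
    then show ?case
      using \<open>\<And>k. descendants n (Suc k) + (2 * n + k choose (n + k + 1)) = (2 * n + k choose n)\<close>
        [of "Suc k"]
      by simp
  qed
  from this[of "Suc k"] show ?case by (simp add: algebra_simps)
qed

theorem corollary5p3:
  fixes n :: nat
  shows "real (card (S1 n)) = 1 / (real n + 1) * real ((2 * n) choose n)"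
proof -
  \<comment> \<open>The root of the tree, the empty sequence, has label 1.\<close>
  have "active_sites [] = {0}"
    by (auto simp: active_sites_def)
  then have "card (S1 n) = descendants n (Suc 0)"
    using card_Theta_fixed_extensions[of "[]" n] by (simp add: card_S1_eq_card_FP FP_eq)
  then have "card (S1 n) + (2 * n choose Suc n) = (2 * n choose n)"
    using descendants_ballot[of n 0] by simp
  \<comment> \<open>Both sides equal \<open>2 * n * (2 * n - 1 choose n)\<close>.\<close>
  moreover have "Suc n * (2 * n choose Suc n) = n * (2 * n choose n)"
    using binomial_absorb_comp[of "2 * n" n] binomial_absorption[of n "2 * n"]
    by (simp only: mult_2 diff_add_inverse2)
  ultimately have "Suc n * card (S1 n) = (2 * n choose n)"
    by (metis add_diff_cancel_right' add_mult_distrib2 mult_Suc)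
  then have "real (Suc n) * real (card (S1 n)) = real (2 * n choose n)"
    by (metis of_nat_mult)
  then show ?thesis
    by (simp add: field_simps)
qed

end
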